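(* Let $A=\{a_1<a_2<\dots<a_n\}$ be a finite ordered set with $n\geq 1$ elements. Then the family of monomials $\mathfrak{B}(A)$ is a basis of the multilinear part of the free algebra with two compatible brackets generated by $A$.
   Context: The ground field has characteristic zero. An algebra with two compatible brackets is a vector space with two skew-symmetric bilinear operations $\{\cdot,\cdot\}_1,\{\cdot,\cdot\}_2$ such that every linear combination of them satisfies the Jacobi identity. The multilinear part of the free algebra of this type generated by $A$ is the span of all monomials containing each element of $A$ exactly once. The family $\mathfrak{B}(A)$ of monomials is defined recursively (subsets of $A$ carry the induced order): - For $A=\{a_1\}$, $\mathfrak{B}(A)=\{a_1\}$. - If $n>1$, a monomial $b$ belongs to $\mathfrak{B}(A)$ if and only if it satisfies either of the two conditions: (1) $b=\{a_i,b'\}_1$, where $i<n$ and $b'\in\mathfrak{B}(A\setminus\{a_i\})$; (2) $b=\{b_1,b_2\}_2$, where $b_1\in\mathfrak{B}(A_1)$, $b_2\in\mathfrak{B}(A_2)$ for some partition $A=A_1\sqcup A_2$ (into nonempty subsets) with $a_n\in A_2$, and either $b_1=a_i$ for some $i$, or $b_1$ is a bracket of the first type $\{\cdot,\cdot\}_1$ of two monomials belonging to the families $\mathfrak{B}$ for some subsets of $A_1$. *)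

theory Defs
  imports Complex_Main
begin

datatype kind = First | Second

locale compatible_algebra = vector_space scale
  for scale :: "'k::field \<Rightarrow> 'v::ab_group_add \<Rightarrow> 'v" +
  fixes br :: "kind \<Rightarrow> 'v \<Rightarrow> 'v \<Rightarrow> 'v"
  assumes br_add_left: "br i (x + y) z = br i x z + br i y z"
    and br_add_right: "br i x (y + z) = br i x y + br i x z"
    and br_scale_left: "br i (scale c x) y = scale c (br i x y)"
    and br_scale_right: "br i x (scale c y) = scale c (br i x y)"
    and br_skew: "br i x y = - br i y x"
    and jacobi: "\<And>c d x y z.
      let b = (\<lambda>u v. scale c (br First u v) + scale d (br Second u v))
      in b (b x y) z + b (b y z) x + b (b z x) y = 0"


text \<open>The free algebra is the set of all terms in the signature of algebras with two brackets
  over the field \<open>'k\<close>, modulo the smallest congruence that enforces the axioms of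
  \<open>compatible_algebra\<close>.\<close>

datatype ('a, 'k) trm =
    Var 'a
  | Zero
  | Plus "('a, 'k) trm" "('a, 'k) trm"
  | Scale 'k "('a, 'k) trm"
  | Br kind "('a, 'k) trm" "('a, 'k) trm"

definition comb :: "'k \<Rightarrow> 'k \<Rightarrow> ('a, 'k) trm \<Rightarrow> ('a, 'k) trm \<Rightarrow> ('a, 'k) trm" where
  "comb c d s t = Plus (Scale c (Br First s t)) (Scale d (Br Second s t))"

inductive eqv :: "('a, 'k::field) trm \<Rightarrow> ('a, 'k) trm \<Rightarrow> bool" where
  eqv_refl: "eqv s s"
| eqv_sym: "eqv s t \<Longrightarrow> eqv t s"
| eqv_trans: "eqv s t \<Longrightarrow> eqv t u \<Longrightarrow> eqv s u"
| eqv_Plus: "eqv s s' \<Longrightarrow> eqv t t' \<Longrightarrow> eqv (Plus s t) (Plus s' t')"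
| eqv_Scale: "eqv s s' \<Longrightarrow> eqv (Scale c s) (Scale c s')"
| eqv_Br: "eqv s s' \<Longrightarrow> eqv t t' \<Longrightarrow> eqv (Br i s t) (Br i s' t')"
| Plus_assoc: "eqv (Plus (Plus s t) u) (Plus s (Plus t u))"
| Plus_commute: "eqv (Plus s t) (Plus t s)"
| Plus_Zero: "eqv (Plus Zero s) s"
| Plus_inverse: "eqv (Plus (Scale (- 1) s) s) Zero"
| Scale_Plus: "eqv (Scale c (Plus s t)) (Plus (Scale c s) (Scale c t))"
| Scale_add: "eqv (Scale (c + d) s) (Plus (Scale c s) (Scale d s))"
| Scale_Scale: "eqv (Scale c (Scale d s)) (Scale (c * d) s)"
| Scale_one: "eqv (Scale 1 s) s"
| Br_Plus_left: "eqv (Br i (Plus s t) u) (Plus (Br i s u) (Br i t u))"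
| Br_Plus_right: "eqv (Br i s (Plus t u)) (Plus (Br i s t) (Br i s u))"
| Br_Scale_left: "eqv (Br i (Scale c s) t) (Scale c (Br i s t))"
| Br_Scale_right: "eqv (Br i s (Scale c t)) (Scale c (Br i s t))"
| Br_skew: "eqv (Br i s t) (Scale (- 1) (Br i t s))"
| Br_jacobi: "eqv (Plus (Plus (comb c d (comb c d s t) u)
                              (comb c d (comb c d t u) s))
                        (comb c d (comb c d u s) t)) Zero"

quotient_type (overloaded) ('a, 'k) free_alg = "('a, 'k::field) trm" / eqv
  by (intro equivpI reflpI sympI transpI) (blast intro: eqv.intros)+

instantiation free_alg :: (type, field) ab_group_add
begin

lift_definition zero_free_alg :: "('a, 'k::field) free_alg" is Zero .

lift_definition plus_free_alg ::
  "('a, 'k::field) free_alg \<Rightarrow> ('a, 'k) free_alg \<Rightarrow> ('a, 'k) free_alg" is Plus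
  by (rule eqv_Plus)

lift_definition uminus_free_alg :: "('a, 'k::field) free_alg \<Rightarrow> ('a, 'k) free_alg"
  is "Scale (- 1)"
  by (rule eqv_Scale)

definition minus_free_alg ::
  "('a, 'k::field) free_alg \<Rightarrow> ('a, 'k) free_alg \<Rightarrow> ('a, 'k) free_alg" where
  "minus_free_alg x y = x + - y"

instance
proof
  fix x y z :: "('a, 'k::field) free_alg"
  show "x + y + z = x + (y + z)" by transfer (rule Plus_assoc)
  show "x + y = y + x" by transfer (rule Plus_commute)
  show "0 + x = x" by transfer (rule Plus_Zero)
  show "- x + x = 0" by transfer (rule Plus_inverse)
  show "x - y = x + - y" by (rule minus_free_alg_def)
qed

end

lift_definition gen :: "'a \<Rightarrow> ('a, 'k::field) free_alg" is Var .

lift_definition fscale :: "'k::field \<Rightarrow> ('a, 'k) free_alg \<Rightarrow> ('a, 'k) free_alg" is Scale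
  by (rule eqv_Scale)

lift_definition fbr ::
  "kind \<Rightarrow> ('a, 'k::field) free_alg \<Rightarrow> ('a, 'k) free_alg \<Rightarrow> ('a, 'k) free_alg" is Br
  by (rule eqv_Br)

global_interpretation free_alg:
  compatible_algebra "fscale :: 'k::field \<Rightarrow> ('a, 'k) free_alg \<Rightarrow> ('a, 'k) free_alg" fbr
proof
  fix c d :: 'k and x y z :: "('a, 'k) free_alg" and i
  show "fscale c (x + y) = fscale c x + fscale c y" by transfer (rule Scale_Plus)
  show "fscale (c + d) x = fscale c x + fscale d x" by transfer (rule Scale_add)
  show "fscale c (fscale d x) = fscale (c * d) x" by transfer (rule Scale_Scale)
  show "fscale 1 x = x" by transfer (rule Scale_one)
  show "fbr i (x + y) z = fbr i x z + fbr i y z" by transfer (rule Br_Plus_left)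
  show "fbr i x (y + z) = fbr i x y + fbr i x z" by transfer (rule Br_Plus_right)
  show "fbr i (fscale c x) y = fscale c (fbr i x y)" by transfer (rule Br_Scale_left)
  show "fbr i x (fscale c y) = fscale c (fbr i x y)" by transfer (rule Br_Scale_right)
  show "fbr i x y = - fbr i y x" by transfer (rule Br_skew)
  show "let b = (\<lambda>u v. fscale c (fbr First u v) + fscale d (fbr Second u v))
        in b (b x y) z + b (b y z) x + b (b z x) y = 0"
    unfolding Let_def by transfer (rule Br_jacobi[unfolded comb_def])
qed


text \<open>The universal property. It is stated for a set \<open>A\<close> of generators: the subalgebra
  generated by \<open>A\<close> is the free algebra on \<open>A\<close>, so that everything about the free algebra
  generated by \<open>A\<close> can be said inside the free algebra on the whole type.\<close>

inductive_set subalg :: "'a set \<Rightarrow> ('a, 'k::field) free_alg set" for A where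
  subalg_gen: "a \<in> A \<Longrightarrow> gen a \<in> subalg A"
| subalg_zero: "0 \<in> subalg A"
| subalg_add: "x \<in> subalg A \<Longrightarrow> y \<in> subalg A \<Longrightarrow> x + y \<in> subalg A"
| subalg_scale: "x \<in> subalg A \<Longrightarrow> fscale c x \<in> subalg A"
| subalg_br: "x \<in> subalg A \<Longrightarrow> y \<in> subalg A \<Longrightarrow> fbr i x y \<in> subalg A"

definition hom_on ::
  "('a, 'k::field) free_alg set \<Rightarrow> ('k \<Rightarrow> 'v::ab_group_add \<Rightarrow> 'v) \<Rightarrow>
   (kind \<Rightarrow> 'v \<Rightarrow> 'v \<Rightarrow> 'v) \<Rightarrow> (('a, 'k) free_alg \<Rightarrow> 'v) \<Rightarrow> bool" where
  "hom_on S scale br h \<longleftrightarrow>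
    (\<forall>x\<in>S. \<forall>y\<in>S. h (x + y) = h x + h y) \<and>
    (\<forall>c. \<forall>x\<in>S. h (fscale c x) = scale c (h x)) \<and>
    (\<forall>i. \<forall>x\<in>S. \<forall>y\<in>S. h (fbr i x y) = br i (h x) (h y))"

context compatible_algebra
begin

primrec ev :: "('a \<Rightarrow> 'v) \<Rightarrow> ('a, 'k) trm \<Rightarrow> 'v" where
  "ev f (Var a) = f a"
| "ev f Zero = 0"
| "ev f (Plus s t) = ev f s + ev f t"
| "ev f (Scale c s) = scale c (ev f s)"
| "ev f (Br i s t) = br i (ev f s) (ev f t)"

lemma ev_eqv: "eqv s t \<Longrightarrow> ev f s = ev f t"
proof (induction rule: eqv.induct)
  case (Br_skew i s t)
  then show ?case using br_skew[of i "ev f s" "ev f t"] by simp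
next
  case (Br_jacobi c d s t u)
  then show ?case using jacobi[of c d "ev f s" "ev f t" "ev f u"]
    by (simp add: comb_def Let_def)
qed (simp_all add: algebra_simps scale_right_distrib scale_left_distrib
       br_add_left br_add_right br_scale_left br_scale_right)

lemma free_alg_extend:
  "\<exists>h :: ('a, 'k) free_alg \<Rightarrow> 'v. hom_on UNIV scale br h \<and> (\<forall>a. h (gen a) = f a)"
proof -
  define h :: "('a, 'k) free_alg \<Rightarrow> 'v" where "h = (\<lambda>x. ev f (rep_free_alg x))"
  have h: "h (abs_free_alg t) = ev f t" for t
    unfolding h_def
    by (rule ev_eqv) (metis Quotient3_free_alg Quotient3_rep_abs eqv_refl)
  have "h (x + y) = h x + h y" for x y
    by (induction x; induction y) (simp add: plus_free_alg.abs_eq h)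
  moreover have "h (fscale c x) = scale c (h x)" for c x
    by (induction x) (simp add: fscale.abs_eq h)
  moreover have "h (fbr i x y) = br i (h x) (h y)" for i x y
    by (induction x; induction y) (simp add: fbr.abs_eq h)
  moreover have "h (gen a) = f a" for a
    by (simp add: gen.abs_eq h)
  ultimately show ?thesis unfolding hom_on_def by blast
qed

lemma subalg_free_extend:
  "\<exists>h :: ('a, 'k) free_alg \<Rightarrow> 'v. hom_on (subalg A) scale br h \<and> (\<forall>a\<in>A. h (gen a) = f a)"
  using free_alg_extend[of f] unfolding hom_on_def by blast

lemma subalg_free_unique:
  fixes h h' :: "('a, 'k) free_alg \<Rightarrow> 'v"
  assumes "hom_on (subalg A) scale br h" "hom_on (subalg A) scale br h'"
    and "\<And>a. a \<in> A \<Longrightarrow> h (gen a) = h' (gen a)"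
    and "x \<in> subalg A"
  shows "h x = h' x"
  using assms(4)
proof (induction rule: subalg.induct)
  case subalg_zero
  have *: "g 0 = 0" if "hom_on (subalg A) scale br g" for g :: "('a, 'k) free_alg \<Rightarrow> 'v"
    using that subalg.subalg_zero[of A] unfolding hom_on_def
    by (metis add_cancel_right_left)
  show ?case by (simp add: *[OF assms(1)] *[OF assms(2)])
qed (use assms in \<open>auto simp: hom_on_def\<close>)

end


datatype 'a monomial = Gen 'a | Bracket kind "'a monomial" "'a monomial"

primrec leaves :: "'a monomial \<Rightarrow> 'a list" where
  "leaves (Gen a) = [a]"
| "leaves (Bracket i s t) = leaves s @ leaves t"

primrec mval :: "'a monomial \<Rightarrow> ('a, 'k::field) free_alg" where
  "mval (Gen a) = gen a"
| "mval (Bracket i s t) = fbr i (mval s) (mval t)"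

definition multilinear_monomials :: "'a set \<Rightarrow> 'a monomial set" where
  "multilinear_monomials A = {m. distinct (leaves m) \<and> set (leaves m) = A}"

definition multilinear_part :: "'a set \<Rightarrow> ('a, 'k::field) free_alg set" where
  "multilinear_part A = free_alg.span (mval ` multilinear_monomials A)"

lemma multilinear_part_subalg: "(multilinear_part A :: ('a, 'k::field) free_alg set) \<subseteq> subalg A"
proof -
  have *: "set (leaves m) \<subseteq> A \<Longrightarrow> (mval m :: ('a, 'k) free_alg) \<in> subalg A" for m
    by (induction m) (auto intro: subalg.intros)
  have "free_alg.subspace (subalg A :: ('a, 'k) free_alg set)"
    by (auto simp: free_alg.subspace_def intro: subalg.intros)
  then show ?thesis
    unfolding multilinear_part_def multilinear_monomials_def
    by (intro free_alg.span_minimal) (use * in blast)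
qed

text \<open>\<open>BB A b\<close> means that the monomial \<open>b\<close> belongs to the family for \<open>A\<close>; the last element
  of \<open>A\<close> is \<open>Max A\<close>.\<close>

inductive BB :: "'a::linorder set \<Rightarrow> 'a monomial \<Rightarrow> bool" where
  BB_single: "BB {a} (Gen a)"
| BB_first: "card A > 1 \<Longrightarrow> a \<in> A \<Longrightarrow> a \<noteq> Max A \<Longrightarrow> BB (A - {a}) b
    \<Longrightarrow> BB A (Bracket First (Gen a) b)"
| BB_second_gen: "card A > 1 \<Longrightarrow> A = A1 \<union> A2 \<Longrightarrow> A1 \<inter> A2 = {} \<Longrightarrow> A1 \<noteq> {} \<Longrightarrow> A2 \<noteq> {}
    \<Longrightarrow> Max A \<in> A2 \<Longrightarrow> BB A1 b1 \<Longrightarrow> BB A2 b2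
    \<Longrightarrow> a \<in> A \<Longrightarrow> b1 = Gen a
    \<Longrightarrow> BB A (Bracket Second b1 b2)"
| BB_second_bracket: "card A > 1 \<Longrightarrow> A = A1 \<union> A2 \<Longrightarrow> A1 \<inter> A2 = {} \<Longrightarrow> A1 \<noteq> {} \<Longrightarrow> A2 \<noteq> {}
    \<Longrightarrow> Max A \<in> A2 \<Longrightarrow> BB A1 b1 \<Longrightarrow> BB A2 b2
    \<Longrightarrow> C \<subseteq> A1 \<Longrightarrow> D \<subseteq> A1 \<Longrightarrow> BB C c \<Longrightarrow> BB D d \<Longrightarrow> b1 = Bracket First c d
    \<Longrightarrow> BB A (Bracket Second b1 b2)"

definition basis_family :: "'a::linorder set \<Rightarrow> 'a monomial set" where
  "basis_family A = {b. BB A b}"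

end

theory Submission
  imports Defs "HOL-Library.List_Lexorder" "HOL-Library.Sublist" "HOL-Library.Function_Algebras"
begin

text \<open>Spanning. It suffices to bracket two basis monomials \<open>b\<close> and \<open>c\<close> over complementary
  subsets of \<open>A\<close>, where by skew-symmetry \<open>c\<close> contains the maximum of \<open>A\<close>. If the result is not
  itself in the family, then \<open>b\<close> is a bracket and the Jacobi identity replaces \<open>b\<close> by its two
  factors. For the first bracket of a second bracket this is the mixed Jacobi identity, the part of
  the pencil condition that is linear in each bracket; apart from terms with smaller left factors it
  produces only second brackets, which are treated first (\<open>fbr_normal_span\<close>).

  Independence. Fix a set \<open>E\<close> of oriented edges coloured by the two kinds of brackets, with endpoints
  among the generators. Functions of a set of generators form an algebra with two compatible
  brackets: \<open>{f, g}\<^sub>i S\<close> is the sum of \<open>\<plusminus> f P * g Q\<close> over the ordered partitions \<open>S = P \<squnion> Q\<close> that are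
  crossed by exactly one edge of \<open>E\<close>, provided that this edge has colour \<open>i\<close>; the sign records its
  direction (\<open>model_compatible\<close>). Mapping a generator to the indicator of its singleton gives a linear
  functional on the multilinear part whose value on a monomial is \<open>\<plusminus>1\<close> if every bracket of the
  monomial is crossed by exactly one edge, of the colour of the bracket (\<open>fits\<close>), and \<open>0\<close> otherwise.

  A monomial of the family is read from the outside inwards as a word \<open>x\<^sub>1 x\<^sub>2 \<dots> x\<^sub>r m\<close>, where \<open>m\<close> is the
  maximum of \<open>A\<close> and each letter \<open>x\<^sub>j\<close> is the left factor of a bracket, either a generator in a
  first bracket or a smaller monomial of the family in a second bracket. The generators of the former
  kind form its spine. Each member \<open>b\<close> of the family gets a coloured tree \<open>dual_tree b\<close> that fits \<open>b\<close>;
  in it the spine followed by \<open>m\<close> is a path of colour \<open>First\<close>. If the tree of \<open>b\<close> also fits another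
  member \<open>b'\<close>, then \<open>b'\<close> must break the edges of this path at its own spine, so its spine is at least
  as long; if it is equally long, comparing the two words from their right ends, and recursively
  inside the letters, shows that \<open>b'\<close> is larger than \<open>b\<close> in a suitable lexicographic order
  (\<open>key_triangular\<close>). Hence the pairing of the family with its trees is triangular with nonzero
  diagonal.\<close>

section \<open>Normal monomials\<close>

abbreviation lvs :: "'a monomial \<Rightarrow> 'a set" where
  "lvs b \<equiv> set (leaves b)"

text \<open>In the monomials of the family this is the largest generator.\<close>

primrec last_leaf :: "'a monomial \<Rightarrow> 'a" where
  "last_leaf (Gen a) = a"
| "last_leaf (Bracket i s t) = last_leaf t"

text \<open>A description of the family by recursion on the monomial alone: \<open>normal b\<close> holds iff \<open>b\<close> belongs
  to the family for the set of its own leaves. Every subterm has its maximum as last leaf, which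
  makes the comparison of last leaves equivalent to the condition that the right factor contains the
  maximum.\<close>

primrec normal :: "'a::linorder monomial \<Rightarrow> bool" where
  "normal (Gen a) \<longleftrightarrow> True"
| "normal (Bracket i s t) \<longleftrightarrow> normal s \<and> normal t \<and> lvs s \<inter> lvs t = {} \<and> last_leaf s < last_leaf t \<and>
     (case i of First \<Rightarrow> (\<exists>a. s = Gen a) | Second \<Rightarrow> (\<nexists>c d. s = Bracket Second c d))"

lemma lvs_nonempty [simp]: "leaves b \<noteq> []" "lvs b \<noteq> {}"
  by (induction b) auto

lemma last_leaf_in [simp]: "last_leaf b \<in> lvs b"
  by (induction b) auto

lemma last_leaf_max: "normal b \<Longrightarrow> x \<in> lvs b \<Longrightarrow> x \<le> last_leaf b"
  by (induction b) (auto dest: order.strict_trans1)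

lemma normal_distinct: "normal b \<Longrightarrow> distinct (leaves b)"
  by (induction b) auto

lemma last_leaf_eq_Max: "normal b \<Longrightarrow> last_leaf b = Max (lvs b)"
  by (intro Max_eqI[symmetric]) (auto simp: last_leaf_max)

lemma last_leaf_less:
  assumes "normal s" "normal t" "lvs s \<inter> lvs t = {}" "m \<in> lvs t" "\<forall>x\<in>lvs s. x \<le> m"
  shows "last_leaf s < last_leaf t"
proof -
  have "last_leaf s \<le> m" using assms(5) by simp
  also have "m \<le> last_leaf t" using assms by (simp add: last_leaf_max)
  finally show ?thesis using assms(3) last_leaf_in[of s] last_leaf_in[of t]
    by (metis disjoint_iff order_le_imp_less_or_eq)
qed

lemma BB_imp_normal: "BB A b \<Longrightarrow> normal b \<and> lvs b = A"
proof (induction rule: BB.induct)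
  case (BB_single a)
  then show ?case by simp
next
  case (BB_first A a b)
  have fin: "finite A" using BB_first.hyps(1) card_ge_0_finite by force
  have "Max A \<in> A" using BB_first.hyps(2) fin by (intro Max_in) auto
  moreover have "\<forall>x\<in>A. x \<le> Max A" using fin by simp
  ultimately have "last_leaf (Gen a) < last_leaf b"
    using BB_first by (intro last_leaf_less[where m = "Max A"]) auto
  then show ?case using BB_first by auto
next
  case (BB_second_gen A A1 A2 b1 b2 a)
  have fin: "finite A" using BB_second_gen.hyps(1) card_ge_0_finite by force
  have "last_leaf b1 < last_leaf b2"
    using BB_second_gen fin by (intro last_leaf_less[where m = "Max A"]) auto
  then show ?case using BB_second_gen by auto
next
  case (BB_second_bracket A A1 A2 b1 b2 C D c d)
  have fin: "finite A" using BB_second_bracket.hyps(1) card_ge_0_finite by force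
  have "last_leaf b1 < last_leaf b2"
    using BB_second_bracket fin by (intro last_leaf_less[where m = "Max A"]) auto
  then show ?case using BB_second_bracket by auto
qed

lemma normal_imp_BB: "normal b \<Longrightarrow> BB (lvs b) b"
proof (induction b)
  case (Gen a)
  then show ?case by (simp add: BB_single)
next
  case (Bracket i s t)
  let ?A = "lvs s \<union> lvs t"
  have ns: "normal s" and nt: "normal t" and dis: "lvs s \<inter> lvs t = {}"
    and less: "last_leaf s < last_leaf t"
    using Bracket.prems by auto
  have card: "card ?A > 1"
    using dis card_Un_disjoint[of "lvs s" "lvs t"] card_gt_0_iff[of "lvs s"] card_gt_0_iff[of "lvs t"]
    by simp
  have "x \<le> last_leaf t" if "x \<in> ?A" for x
    using that less last_leaf_max[OF ns, of x] last_leaf_max[OF nt, of x] by auto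
  then have Max: "Max ?A = last_leaf t" by (intro Max_eqI) auto
  show ?case
  proof (cases i)
    case First
    then obtain a where s: "s = Gen a" using Bracket.prems by auto
    have "BB ?A (Bracket First (Gen a) t)"
    proof (rule BB_first)
      show "BB (?A - {a}) t" using Bracket.IH(2)[OF nt] dis s by (simp add: insert_Diff_if)
      show "a \<noteq> Max ?A" using less Max s by simp
    qed (use card s in auto)
    then show ?thesis using First s by simp
  next
    case Second
    have "BB ?A (Bracket Second s t)"
    proof (cases s)
      case (Gen a)
      show ?thesis
        by (rule BB_second_gen[OF card refl dis, where a = a])
          (use Bracket.IH ns nt Max Gen in auto)
    next
      case (Bracket j c d)
      then have j: "j = First" using Bracket.prems Second by (cases j) auto
      have "BB (lvs c) c" "BB (lvs d) d" 
        using ns Bracket j BB_single Bracket.IH(1)[OF ns]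
        by (auto elim: BB.cases)
      then show ?thesis
        by (intro BB_second_bracket[OF card refl dis, where C = "lvs c" and D = "lvs d" and c = c and d = d])
          (use Bracket.IH ns nt Max Bracket j in auto)
    qed
    then show ?thesis using Second by simp
  qed
qed

lemma basis_family_eq: "basis_family A = {b. normal b \<and> lvs b = A}"
  using BB_imp_normal normal_imp_BB by (auto simp: basis_family_def)

section \<open>Spanning\<close>

text \<open>The span of the family for \<open>A\<close>.\<close>

definition normal_span :: "'a::linorder set \<Rightarrow> ('a, 'k::field) free_alg set" where
  "normal_span A = free_alg.span (mval ` {b. normal b \<and> lvs b = A})"

lemma normal_span_base: "normal b \<Longrightarrow> lvs b = A \<Longrightarrow> mval b \<in> normal_span A"
  unfolding normal_span_def by (intro free_alg.span_base) auto

lemma subspace_normal_span: "free_alg.subspace (normal_span A)"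
  unfolding normal_span_def by (rule free_alg.subspace_span)

lemmas normal_span_add = free_alg.subspace_add[OF subspace_normal_span]
  and normal_span_diff = free_alg.subspace_diff[OF subspace_normal_span]
  and normal_span_neg = free_alg.subspace_neg[OF subspace_normal_span]

lemma fbr_zero_right [simp]: "fbr i x 0 = 0"
  using free_alg.br_add_right[of i x 0 0] by simp

lemma fbr_zero_left [simp]: "fbr i 0 x = 0"
  using free_alg.br_add_left[of i 0 0 x] by simp

lemma fbr_neg_right: "fbr i y (- x) = - fbr i y x"
  using free_alg.br_add_right[of i y x "- x"] by (simp add: eq_neg_iff_add_eq_0 add.commute)

lemma normal_span_right:
  assumes "y \<in> normal_span Q"
    and "\<And>b. normal b \<Longrightarrow> lvs b = Q \<Longrightarrow> fbr i z (mval b) \<in> normal_span A"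
  shows "fbr i z y \<in> normal_span A"
proof -
  have "free_alg.subspace {y. fbr i z y \<in> normal_span A}"
    using subspace_normal_span[of A]
    by (auto simp: free_alg.subspace_def free_alg.br_add_right free_alg.br_scale_right)
  then have "normal_span Q \<subseteq> {y. fbr i z y \<in> normal_span A}"
    unfolding normal_span_def[of Q] using assms(2) by (intro free_alg.span_minimal) auto
  then show ?thesis using assms(1) by blast
qed

lemma normal_span_left:
  assumes "y \<in> normal_span Q"
    and "\<And>b. normal b \<Longrightarrow> lvs b = Q \<Longrightarrow> fbr i (mval b) z \<in> normal_span A"
  shows "fbr i y z \<in> normal_span A"
proof -
  have *: "fbr i y' z \<in> normal_span A \<longleftrightarrow> fbr i z y' \<in> normal_span A" for y'
    using normal_span_neg[of "fbr i y' z" A] normal_span_neg[of "fbr i z y'" A] free_alg.br_skew[of i y' z]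
    by (metis minus_minus)
  show ?thesis using normal_span_right[of y Q i z A] assms * by blast
qed

lemma jacobi_pure: "fbr i (fbr i x y) z = fbr i x (fbr i y z) - fbr i y (fbr i x z)"
proof -
  have "fbr i (fbr i x y) z + fbr i (fbr i y z) x + fbr i (fbr i z x) y = 0"
    using free_alg.jacobi[of 1 0 x y z] free_alg.jacobi[of 0 1 x y z] by (cases i) (auto simp: Let_def)
  moreover have "fbr i (fbr i y z) x = - fbr i x (fbr i y z)"
    by (rule free_alg.br_skew)
  moreover have "fbr i (fbr i z x) y = fbr i y (fbr i x z)"
    using free_alg.br_skew[of i "fbr i z x" y] free_alg.br_skew[of i z x] by (simp add: fbr_neg_right)
  ultimately show ?thesis by (simp add: algebra_simps eq_neg_iff_add_eq_0)
qed

text \<open>The polarisation of the Jacobi identity for the sum of the two brackets.\<close>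

lemma jacobi_mixed:
  "fbr First (fbr Second x y) z = - fbr Second (fbr First x y) z
     + fbr Second x (fbr First y z) - fbr Second y (fbr First x z)
     + fbr First x (fbr Second y z) - fbr First y (fbr Second x z)"
proof -
  let ?J = "\<lambda>i j. fbr j (fbr i x y) z + fbr j (fbr i y z) x + fbr j (fbr i z x) y"
  have 1: "?J First First = 0" "?J Second Second = 0"
    using free_alg.jacobi[of 1 0 x y z] free_alg.jacobi[of 0 1 x y z] by (auto simp: Let_def)
  have "(?J First First + ?J Second Second) + (?J First Second + ?J Second First) = 0"
    using free_alg.jacobi[of 1 1 x y z]
    by (simp add: Let_def free_alg.br_add_left algebra_simps)
  then have *: "?J First Second + ?J Second First = 0" by (simp only: 1 add_0)
  have s: "fbr j (fbr i y z) x = - fbr j x (fbr i y z)" "fbr j (fbr i z x) y = fbr j y (fbr i x z)" for i j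
    using free_alg.br_skew[of j "fbr i y z" x] free_alg.br_skew[of j "fbr i z x" y] free_alg.br_skew[of i z x]
    by (simp_all add: fbr_neg_right)
  show ?thesis using * unfolding s by (simp add: algebra_simps eq_neg_iff_add_eq_0)
qed

text \<open>Outer induction on the number of generators; inside, first brackets depend on second ones, and
  each is treated by structural induction on the left factor, as long as the right one contains the
  maximum \<open>m\<close>.\<close>

lemma fbr_normal_span:
  fixes x y :: "('a::linorder, 'k::field) free_alg"
  assumes "finite (P \<union> Q)" "P \<inter> Q = {}" "x \<in> normal_span P" "y \<in> normal_span Q"
  shows "fbr i x y \<in> normal_span (P \<union> Q)"
  using assms
proof (induction "card (P \<union> Q)" arbitrary: P Q x y i rule: less_induct)
  case less
  define A where "A = P \<union> Q"
  have finA: "finite A" using less.prems A_def by simp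
  have IH: "fbr i x y \<in> normal_span (P' \<union> Q')"
    if "P' \<union> Q' \<subset> A" "P' \<inter> Q' = {}" "x \<in> normal_span P'" "y \<in> normal_span Q'" for P' Q' i and x y :: "('a, 'k) free_alg"
    using less.hyps[of P' Q' x y i] psubset_card_mono[OF finA that(1)] that finite_subset[OF _ finA]
    unfolding A_def by blast
  have psub: "X \<union> Y \<subset> A" if "lvs b \<union> (X \<union> Y) = A" "lvs b \<inter> (X \<union> Y) = {}" for b X Y
    using that last_leaf_in[of b] by blast
  define m where "m = Max A"
  have m: "\<forall>x\<in>A. x \<le> m" unfolding m_def using finA by simp
  have basic: "(mval (Bracket i b c) :: ('a, 'k) free_alg) \<in> normal_span A"
    if "normal b" "normal c" "lvs b \<union> lvs c = A" "lvs b \<inter> lvs c = {}" "m \<in> lvs c"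
      "case i of First \<Rightarrow> (\<exists>a. b = Gen a) | Second \<Rightarrow> (\<nexists>c d. b = Bracket Second c d)" for b c i
    using that m by (intro normal_span_base) (auto intro!: last_leaf_less[where m = m])
  have second: "fbr Second (mval b) y \<in> normal_span A"
    if "normal b" "lvs b \<union> Q = A" "lvs b \<inter> Q = {}" "m \<in> Q" "y \<in> normal_span Q" for b Q and y :: "('a, 'k) free_alg"
    using that
  proof (induction b arbitrary: Q y)
    case (Gen a)
    then show ?case
      using basic[of "Gen a" _ Second] by (intro normal_span_right[OF Gen.prems(5)]) auto
  next
    case (Bracket j s t)
    show ?case
    proof (cases j)
      case First
      then show ?thesis
        using basic[of "Bracket j s t" _ Second] Bracket.prems
        by (intro normal_span_right[OF Bracket.prems(5)]) auto
    next
      case Second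
      have "fbr Second (mval s) (fbr Second (mval t) y) \<in> normal_span A"
        using Bracket.prems
        by (intro Bracket.IH(1)[where Q = "lvs t \<union> Q"] IH psub[of s] normal_span_base) auto
      moreover have "fbr Second (mval t) (fbr Second (mval s) y) \<in> normal_span A"
        using Bracket.prems
        by (intro Bracket.IH(2)[where Q = "lvs s \<union> Q"] IH psub[of t] normal_span_base) auto
      ultimately show ?thesis
        using Second by (simp add: jacobi_pure[of Second "mval s"] normal_span_diff)
    qed
  qed
  have skew: "fbr i x y \<in> normal_span A \<longleftrightarrow> fbr i y x \<in> normal_span A" for i and x y :: "('a, 'k) free_alg"
    using normal_span_neg[of "fbr i x y" A] normal_span_neg[of "fbr i y x" A] free_alg.br_skew[of i x y]
    by (metis minus_minus)
  have split: "fbr i x y \<in> normal_span A"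
    if "P \<union> Q = A" "P \<inter> Q = {}" "x \<in> normal_span P" "y \<in> normal_span Q"
      and main: "\<And>b Q (y :: ('a, 'k) free_alg). normal b \<Longrightarrow> lvs b \<union> Q = A \<Longrightarrow> lvs b \<inter> Q = {} \<Longrightarrow> m \<in> Q
        \<Longrightarrow> y \<in> normal_span Q \<Longrightarrow> fbr i (mval b) y \<in> normal_span A" for P Q i and x y :: "('a, 'k) free_alg"
  proof (cases "A = {}")
    case True
    then have "x = 0" using that by (auto simp: normal_span_def)
    then show ?thesis using free_alg.subspace_0[OF subspace_normal_span] by simp
  next
    case False
    then have "m \<in> A" unfolding m_def using finA by simp
    then consider "m \<in> P" | "m \<in> Q" using \<open>P \<union> Q = A\<close> by blast
    then show ?thesis
    proof cases
      case 1
      then have "fbr i y x \<in> normal_span A"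
        using that by (intro normal_span_left[OF that(4)] main[of _ P]) auto
      then show ?thesis using skew by blast
    next
      case 2
      then show ?thesis
        using that by (intro normal_span_left[OF that(3)] main[of _ Q]) auto
    qed
  qed
  have second_all: "fbr Second x y \<in> normal_span A"
    if "P \<union> Q = A" "P \<inter> Q = {}" "x \<in> normal_span P" "y \<in> normal_span Q" for P Q and x y :: "('a, 'k) free_alg"
    using split[OF that second] .
  have first: "fbr First (mval b) y \<in> normal_span A"
    if "normal b" "lvs b \<union> Q = A" "lvs b \<inter> Q = {}" "m \<in> Q" "y \<in> normal_span Q" for b Q and y :: "('a, 'k) free_alg"
    using that
  proof (induction b arbitrary: Q y)
    case (Gen a)
    then show ?case
      using basic[of "Gen a" _ First] by (intro normal_span_right[OF Gen.prems(5)]) auto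
  next
    case (Bracket j s t)
    have st: "normal s" "normal t" "lvs s \<inter> lvs t = {}" "lvs s \<union> lvs t \<union> Q = A" 
      "lvs s \<inter> Q = {}" "lvs t \<inter> Q = {}" "m \<in> Q" "y \<in> normal_span Q"
      using Bracket.prems by auto
    have sy: "fbr k (mval s) y \<in> normal_span (lvs s \<union> Q)" for k
      using st by (intro IH psub[of t] normal_span_base) auto
    have ty: "fbr k (mval t) y \<in> normal_span (lvs t \<union> Q)" for k
      using st by (intro IH psub[of s] normal_span_base) auto
    have sty: "fbr First (mval s) (fbr k (mval t) y) \<in> normal_span A" for k
      using st by (intro Bracket.IH(1)[OF _ _ _ _ ty]) auto
    have tsy: "fbr First (mval t) (fbr k (mval s) y) \<in> normal_span A" for k
      using st by (intro Bracket.IH(2)[OF _ _ _ _ sy]) auto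
    show ?case
    proof (cases j)
      case First
      then show ?thesis
        using sty tsy by (simp add: jacobi_pure[of First "mval s"] normal_span_diff)
    next
      case Second
      have "(fbr First (mval s) (mval t) :: ('a, 'k) free_alg) \<in> normal_span (lvs s \<union> lvs t)"
      proof (rule IH)
        show "lvs s \<union> lvs t \<subset> A" using st by blast
      qed (use st in \<open>auto intro: normal_span_base\<close>)
      then have "fbr Second (fbr First (mval s) (mval t)) y \<in> normal_span A"
        using st by (intro second_all[of "lvs s \<union> lvs t" Q]) auto
      moreover have "fbr Second (mval s) (fbr First (mval t) y) \<in> normal_span A"
        using st by (intro second_all[OF _ _ _ ty] normal_span_base) auto
      moreover have "fbr Second (mval t) (fbr First (mval s) y) \<in> normal_span A"
        using st by (intro second_all[OF _ _ _ sy] normal_span_base) auto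
      ultimately show ?thesis
        using sty tsy Second unfolding mval.simps
        by (simp only: jacobi_mixed[of "mval s"])
          (intro normal_span_add normal_span_diff normal_span_neg; assumption)
    qed
  qed
  show ?case
    unfolding A_def[symmetric]
    by (cases i) (use split[OF _ less.prems(2-4) first] second_all[OF _ less.prems(2-4)] A_def in auto)
qed

lemma mval_normal_span: "distinct (leaves m) \<Longrightarrow> mval m \<in> normal_span (lvs m)"
proof (induction m)
  case (Gen a)
  then show ?case by (intro normal_span_base) auto
qed (auto intro: fbr_normal_span)

lemma span_basis_family:
  "free_alg.span (mval ` basis_family A) = (multilinear_part A :: ('a::linorder, 'k::field) free_alg set)"
proof
  show "free_alg.span (mval ` basis_family A) \<subseteq> (multilinear_part A :: ('a, 'k) free_alg set)"
    unfolding multilinear_part_def multilinear_monomials_def basis_family_eq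
    by (intro free_alg.span_mono) (auto simp: normal_distinct)
  show "(multilinear_part A :: ('a, 'k) free_alg set) \<subseteq> free_alg.span (mval ` basis_family A)"
    unfolding multilinear_part_def multilinear_monomials_def
  proof (rule free_alg.span_minimal)
    show "mval ` {m. distinct (leaves m) \<and> lvs m = A}
        \<subseteq> (free_alg.span (mval ` basis_family A) :: ('a, 'k) free_alg set)"
      using mval_normal_span unfolding normal_span_def basis_family_eq by blast
  qed (rule free_alg.subspace_span)
qed

section \<open>Pairing monomials with edge sets\<close>

text \<open>Oriented coloured edges. No tree condition is imposed until a tree is attached to a monomial.\<close>

type_synonym 'a edges = "('a \<times> kind \<times> 'a) set"

text \<open>The edges that join \<open>P\<close> and \<open>Q\<close>, in either direction.\<close>

definition cross :: "'a edges \<Rightarrow> 'a set \<Rightarrow> 'a set \<Rightarrow> 'a edges" where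
  "cross E P Q = {(u, i, v) \<in> E. u \<in> P \<and> v \<in> Q \<or> u \<in> Q \<and> v \<in> P}"

text \<open>For disjoint \<open>P\<close> and \<open>Q\<close> this is the structure constant of bracket \<open>i\<close>: it is nonzero iff a
  single edge joins \<open>P\<close> and \<open>Q\<close> and this edge has colour \<open>i\<close>, and it is \<open>1\<close> if the edge starts in \<open>P\<close>
  and \<open>-1\<close> if it starts in \<open>Q\<close>.\<close>

definition weight :: "'a edges \<Rightarrow> kind \<Rightarrow> 'a set \<Rightarrow> 'a set \<Rightarrow> 'k::field" where
  "weight E i P Q =
    (if \<exists>u v. cross E P Q = {(u, i, v)} \<and> u \<in> P then 1
     else if \<exists>u v. cross E P Q = {(u, i, v)} \<and> u \<in> Q then - 1 else 0)"

text \<open>Every bracket of the monomial is crossed by exactly one edge, and its colour is the kind of the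
  bracket.\<close>

primrec fits :: "'a edges \<Rightarrow> 'a monomial \<Rightarrow> bool" where
  "fits E (Gen a) \<longleftrightarrow> True"
| "fits E (Bracket i s t) \<longleftrightarrow> fits E s \<and> fits E t \<and> (\<exists>u v. cross E (lvs s) (lvs t) = {(u, i, v)})"

lemma cross_commute: "cross E P Q = cross E Q P"
  by (auto simp: cross_def)

lemma cross_Un: "cross E (P \<union> Q) R = cross E P R \<union> cross E Q R"
  by (auto simp: cross_def)

lemma cross_disjoint: "P \<inter> Q = {} \<Longrightarrow> Q \<inter> R = {} \<Longrightarrow> P \<inter> R = {} \<Longrightarrow> cross E P R \<inter> cross E Q R = {}"
  by (auto simp: cross_def)

lemma weight_skew: "P \<inter> Q = {} \<Longrightarrow> weight E i P Q = - weight E i Q P"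
  by (auto simp: weight_def cross_commute[of E P Q])

lemma weight_empty: "cross E P Q = {} \<Longrightarrow> weight E i P Q = 0"
  by (auto simp: weight_def)

lemma weight_nonzero:
  "(weight E i P Q :: 'k::field) \<noteq> 0 \<longleftrightarrow> (\<exists>u v. cross E P Q = {(u, i, v)})"
proof -
  have "u \<in> P \<or> u \<in> Q" if "cross E P Q = {(u, i, v)}" for u v
    using that by (auto simp: cross_def)
  then show ?thesis by (auto simp: weight_def)
qed

lemma weight_Un_absorb:
  assumes "P \<inter> Q = {}" "Q \<inter> R = {}" "cross E Q R = {}"
  shows "weight E i (P \<union> Q) R = weight E i P R"
proof -
  have "u \<notin> Q" if "cross E P R = {(u, i, v)}" for u v
  proof -
    have "(u, i, v) \<in> cross E P R" using that by simp
    then show ?thesis using assms(1,2) by (auto simp: cross_def)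
  qed
  then have "(\<exists>u v. cross E P R = {(u, i, v)} \<and> u \<in> P \<union> Q) \<longleftrightarrow> (\<exists>u v. cross E P R = {(u, i, v)} \<and> u \<in> P)"
    by blast
  then show ?thesis
    using assms(3) by (simp only: weight_def cross_Un Un_empty_right)
qed

lemma weight_Un:
  assumes "P \<inter> Q = {}" "Q \<inter> R = {}" "P \<inter> R = {}"
  shows "(weight E i (P \<union> Q) R :: 'k::field) =
    (if cross E Q R = {} then weight E i P R else if cross E P R = {} then weight E i Q R else 0)"
proof (cases "cross E Q R = {}")
  case True
  then show ?thesis using weight_Un_absorb[of P Q R E i] assms by simp
next
  case QR: False
  show ?thesis
  proof (cases "cross E P R = {}")
    case True
    have "Q \<inter> P = {}" using assms(1) by blast
    then show ?thesis
      using weight_Un_absorb[OF _ assms(3) True, of Q i] QR True by (simp add: Un_commute[of P Q])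
  next
    case False
    obtain e e' where e: "e \<in> cross E P R" "e' \<in> cross E Q R" using QR False by blast
    then have "e \<noteq> e'" using cross_disjoint[OF assms, of E] by blast
    then have "cross E (P \<union> Q) R \<noteq> {x}" for x
      using e unfolding cross_Un by (metis UnI1 UnI2 singletonD)
    then show ?thesis using QR False by (simp add: weight_def)
  qed
qed

text \<open>The Jacobi identity of the model, for every linear combination of the two brackets, reduces to this
  identity of structure constants. A product of two of them survives only if one of the three sets is
  joined to each of the other two by a single edge and these two are not joined; then it occurs twice,
  with opposite signs.\<close>

lemma weight_jacobi:
  fixes c d :: "'k::field" and E :: "'a edges"
  assumes "P \<inter> Q = {}" "Q \<inter> R = {}" "P \<inter> R = {}"
  defines "w \<equiv> \<lambda>P Q. c * weight E First P Q + d * weight E Second P Q"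
  shows "w (P \<union> Q) R * w P Q + w (Q \<union> R) P * w Q R + w (R \<union> P) Q * w R P = 0"
proof -
  have skew: "w X Y = - w Y X" if "X \<inter> Y = {}" for X Y
    using weight_skew[OF that, of E First, where 'b = 'k]
      weight_skew[OF that, of E Second, where 'b = 'k] by (simp add: w_def)
  have z: "w X Y = 0" if "cross E X Y = {}" for X Y
    using that by (simp add: w_def weight_empty)
  have un: "w (X \<union> Y) Z =
      (if cross E Y Z = {} then w X Z else if cross E X Z = {} then w Y Z else 0)"
    if "X \<inter> Y = {}" "Y \<inter> Z = {}" "X \<inter> Z = {}" for X Y Z
    by (simp add: w_def weight_Un[OF that])
  have s: "w Q P = - w P Q" "w R P = - w P R" "w R Q = - w Q R"
    using assms(1-3) by (auto intro: skew)
  have dis: "R \<inter> P = {}" "Q \<inter> P = {}" "R \<inter> Q = {}"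
    using assms(1-3) by auto
  have "w (P \<union> Q) R = (if cross E Q R = {} then w P R else if cross E P R = {} then w Q R else 0)"
    using assms(1-3) by (intro un) auto
  moreover have "w (Q \<union> R) P = (if cross E P R = {} then w Q P else if cross E P Q = {} then w R P else 0)"
    using un[of Q R P] assms(1-3) dis by (simp add: cross_commute[of E R P] cross_commute[of E Q P])
  moreover have "w (R \<union> P) Q = (if cross E P Q = {} then w R Q else if cross E Q R = {} then w P Q else 0)"
    using un[of R P Q] assms(1-3) dis by (simp add: cross_commute[of E R Q])
  ultimately show ?thesis
    using s z[of P Q] z[of Q R] z[of P R]
    by (cases "cross E P Q = {}"; cases "cross E Q R = {}"; cases "cross E P R = {}") (simp_all add: algebra_simps)
qed

text \<open>On infinite \<open>S\<close> the sum is \<open>0\<close>, so all identities hold there trivially.\<close>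

definition model_br ::
  "'a edges \<Rightarrow> kind \<Rightarrow> ('a set \<Rightarrow> 'k::field) \<Rightarrow> ('a set \<Rightarrow> 'k) \<Rightarrow> 'a set \<Rightarrow> 'k" where
  "model_br E i f g = (\<lambda>S. \<Sum>P\<in>Pow S. weight E i P (S - P) * f P * g (S - P))"

text \<open>Ordered partitions into three, possibly empty, parts.\<close>

definition tripartitions :: "'a set \<Rightarrow> ('a set \<times> 'a set \<times> 'a set) set" where
  "tripartitions S = {(P, Q, R). P \<union> Q \<union> R = S \<and> P \<inter> Q = {} \<and> Q \<inter> R = {} \<and> P \<inter> R = {}}"

lemma tripartitions_rotate:
  "(\<Sum>(P, Q, R)\<in>tripartitions S. h Q R P) = (\<Sum>(P, Q, R)\<in>tripartitions S. h P Q R)"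
  by (rule sum.reindex_bij_witness[where i = "\<lambda>(P, Q, R). (R, P, Q)" and j = "\<lambda>(P, Q, R). (Q, R, P)"])
    (auto simp: tripartitions_def)

lemma sum_nested_partitions:
  assumes "finite S"
  shows "(\<Sum>T\<in>Pow S. \<Sum>P\<in>Pow T. h P (T - P) (S - T)) = (\<Sum>(P, Q, R)\<in>tripartitions S. h P Q R)"
proof -
  have "(\<Sum>T\<in>Pow S. \<Sum>P\<in>Pow T. h P (T - P) (S - T)) = (\<Sum>(T, P)\<in>Sigma (Pow S) Pow. h P (T - P) (S - T))"
    using assms by (intro sum.Sigma) (auto intro: finite_subset)
  also have "\<dots> = (\<Sum>(P, Q, R)\<in>tripartitions S. h P Q R)"
    by (rule sum.reindex_bij_witness[where i = "\<lambda>(P, Q, R). (P \<union> Q, P)" and j = "\<lambda>(T, P). (P, T - P, S - T)"])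
      (auto simp: tripartitions_def)
  finally show ?thesis .
qed

lemma model_compatible:
  "compatible_algebra (\<lambda>(c::'k::field) f (S::'a set). c * f S) (model_br E)"
proof
  fix c d :: 'k and x y z :: "'a set \<Rightarrow> 'k" and i
  show "(\<lambda>S. c * (x + y) S) = (\<lambda>S. c * x S) + (\<lambda>S. c * y S)"
    by (auto simp: algebra_simps)
  show "(\<lambda>S. (c + d) * x S) = (\<lambda>S. c * x S) + (\<lambda>S. d * x S)"
    by (auto simp: algebra_simps)
  show "(\<lambda>S. c * (d * x S)) = (\<lambda>S. c * d * x S)"
    by (auto simp: algebra_simps)
  show "(\<lambda>S. 1 * x S) = x" by simp
  show "model_br E i (x + y) z = model_br E i x z + model_br E i y z"
    by (auto simp: model_br_def algebra_simps sum.distrib)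
  show "model_br E i x (y + z) = model_br E i x y + model_br E i x z"
    by (auto simp: model_br_def algebra_simps sum.distrib)
  show "model_br E i (\<lambda>S. c * x S) y = (\<lambda>S. c * model_br E i x y S)"
    by (auto simp: model_br_def algebra_simps sum_distrib_left)
  show "model_br E i x (\<lambda>S. c * y S) = (\<lambda>S. c * model_br E i x y S)"
    by (auto simp: model_br_def algebra_simps sum_distrib_left)
  show "model_br E i x y = - model_br E i y x"
  proof
    fix S
    have "(\<Sum>P\<in>Pow S. weight E i P (S - P) * x P * y (S - P))
        = (\<Sum>P\<in>Pow S. weight E i (S - P) P * x (S - P) * y P)"
      by (rule sum.reindex_bij_witness[where i = "\<lambda>P. S - P" and j = "\<lambda>P. S - P"])
        (auto simp: double_diff)
    also have "\<dots> = (\<Sum>P\<in>Pow S. - (weight E i P (S - P) * y P * x (S - P)))"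
      by (intro sum.cong refl) (subst weight_skew, auto)
    finally show "model_br E i x y S = (- model_br E i y x) S"
      by (simp add: model_br_def sum_negf)
  qed
  show "let b = (\<lambda>u v. (\<lambda>S. c * model_br E First u v S) + (\<lambda>S. d * model_br E Second u v S))
        in b (b x y) z + b (b y z) x + b (b z x) y = 0"
  proof -
    define w :: "'a set \<Rightarrow> 'a set \<Rightarrow> 'k" where
      "w = (\<lambda>P Q. c * weight E First P Q + d * weight E Second P Q)"
    define b where "b = (\<lambda>u v. (\<lambda>S. c * model_br E First u v S) + (\<lambda>S. d * model_br E Second u v S))"
    have b: "b u v S = (\<Sum>P\<in>Pow S. w P (S - P) * u P * v (S - P))" for u v S
      by (simp add: b_def w_def model_br_def sum_distrib_left algebra_simps flip: sum.distrib)
    have bb: "b (b u v) r S = (\<Sum>(P, Q, R)\<in>tripartitions S. w (P \<union> Q) R * w P Q * u P * v Q * r R)"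
      if "finite S" for u v r S
    proof -
      have "b (b u v) r S = (\<Sum>T\<in>Pow S. \<Sum>P\<in>Pow T. w (P \<union> (T - P)) (S - T) * w P (T - P) * u P * v (T - P) * r (S - T))"
        unfolding b by (intro sum.cong refl) (auto simp: sum_distrib_left sum_distrib_right Un_absorb1 mult_ac intro!: sum.cong)
      also have "\<dots> = (\<Sum>(P, Q, R)\<in>tripartitions S. w (P \<union> Q) R * w P Q * u P * v Q * r R)"
        by (rule sum_nested_partitions[OF that])
      finally show ?thesis .
    qed
    have "b (b x y) z S + b (b y z) x S + b (b z x) y S = 0" for S
    proof (cases "finite S")
      case True
      have "b (b y z) x S = (\<Sum>(P, Q, R)\<in>tripartitions S. w (Q \<union> R) P * w Q R * y Q * z R * x P)"
        unfolding bb[OF True]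
        by (rule tripartitions_rotate[symmetric, where h = "\<lambda>P Q R. w (P \<union> Q) R * w P Q * y P * z Q * x R"])
      moreover have "b (b z x) y S = (\<Sum>(P, Q, R)\<in>tripartitions S. w (R \<union> P) Q * w R P * z R * x P * y Q)"
        unfolding bb[OF True]
        using tripartitions_rotate[where h = "\<lambda>P Q R. w (P \<union> Q) R * w P Q * z P * x Q * y R" and S = S]
          tripartitions_rotate[where h = "\<lambda>P Q R. w (Q \<union> R) P * w Q R * z Q * x R * y P" and S = S]
        by simp
      ultimately have "b (b x y) z S + b (b y z) x S + b (b z x) y S =
        (\<Sum>(P, Q, R)\<in>tripartitions S. (w (P \<union> Q) R * w P Q + w (Q \<union> R) P * w Q R + w (R \<union> P) Q * w R P) * (x P * y Q * z R))"
        unfolding bb[OF True] by (simp add: case_prod_beta algebra_simps flip: sum.distrib)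
      also have "\<dots> = 0"
        using weight_jacobi[of _ _ _ c E d] by (intro sum.neutral) (auto simp: tripartitions_def w_def)
      finally show ?thesis .
    next
      case False
      then show ?thesis by (simp add: b)
    qed
    then show ?thesis unfolding b_def[symmetric] Let_def by (auto simp: fun_eq_iff)
  qed
qed

text \<open>The value of the functional given by \<open>E\<close> on a monomial with distinct leaves.\<close>

primrec sign :: "'a edges \<Rightarrow> 'a monomial \<Rightarrow> 'k::field" where
  "sign E (Gen a) = 1"
| "sign E (Bracket i s t) = weight E i (lvs s) (lvs t) * sign E s * sign E t"

lemma sign_nonzero: "(sign E b :: 'k::field) \<noteq> 0 \<longleftrightarrow> fits E b"
  by (induction b) (auto simp: weight_nonzero)

lemma pairing_exists:
  fixes E :: "'a edges"
  obtains h :: "('a, 'k::field) free_alg \<Rightarrow> 'k"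
  where "\<And>x y. h (x + y) = h x + h y" "\<And>c x. h (fscale c x) = c * h x"
    "\<And>b. distinct (leaves b) \<Longrightarrow> lvs b = A \<Longrightarrow> h (mval b) = sign E b"
proof -
  interpret model: compatible_algebra "\<lambda>(c::'k) f (S::'a set). c * f S" "model_br E"
    by (rule model_compatible)
  obtain H :: "('a, 'k) free_alg \<Rightarrow> 'a set \<Rightarrow> 'k" where
    H: "hom_on UNIV (\<lambda>c f S. c * f S) (model_br E) H" "\<And>a. H (gen a) = (\<lambda>S. if S = {a} then 1 else 0)"
    using model.free_alg_extend[of "\<lambda>a S. if S = {a} then 1 else 0"] by blast
  have val: "H (mval b) = (\<lambda>S. if S = lvs b then sign E b else 0)" if "distinct (leaves b)" for b
    using that
  proof (induction b)
    case (Gen a)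
    then show ?case by (auto simp: H fun_eq_iff)
  next
    case (Bracket i s t)
    have "H (mval (Bracket i s t)) S = (if S = lvs s \<union> lvs t then sign E (Bracket i s t) else 0)" for S
    proof -
      have "H (mval (Bracket i s t)) S = (\<Sum>P\<in>Pow S. weight E i P (S - P)
          * (if P = lvs s then sign E s else 0) * (if S - P = lvs t then sign E t else 0))"
        using H(1) Bracket by (simp add: hom_on_def model_br_def)
      also have "\<dots> = (\<Sum>P\<in>Pow S. if P = lvs s then
          (if S = lvs s \<union> lvs t then sign E (Bracket i s t) else 0) else 0)"
        using Bracket.prems by (intro sum.cong refl) auto
      also have "\<dots> = (if S = lvs s \<union> lvs t then sign E (Bracket i s t) else 0)"
        by (cases "finite S") (auto simp: sum.delta)
      finally show ?thesis .
    qed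
    then show ?case by (auto simp: fun_eq_iff)
  qed
  show thesis
    by (rule that[of "\<lambda>x. H x A"]) (use H(1) val in \<open>auto simp: hom_on_def\<close>)
qed

section \<open>The dual tree of a monomial\<close>

text \<open>In the word of a monomial, \<open>core\<close> is the first generator of the spine, or the final letter if the
  spine is empty. New letters of a first bracket are attached to it by an edge.\<close>

primrec core :: "'a monomial \<Rightarrow> 'a" where
  "core (Gen a) = a"
| "core (Bracket i s t) = (case i of First \<Rightarrow> core s | Second \<Rightarrow> core t)"

text \<open>The place where a new letter of a second bracket is attached: the core of the first letter. Thus
  consecutive letters of second brackets form a chain that hangs on the core of the word after them.\<close>

primrec tip :: "'a monomial \<Rightarrow> 'a" where
  "tip (Gen a) = a"
| "tip (Bracket i s t) = core s"

text \<open>Each bracket contributes one edge of its own colour between its two factors.\<close>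

primrec dual_tree :: "'a monomial \<Rightarrow> 'a edges" where
  "dual_tree (Gen a) = {}"
| "dual_tree (Bracket i s t) =
    insert (core s, i, case i of First \<Rightarrow> core t | Second \<Rightarrow> tip t) (dual_tree s \<union> dual_tree t)"

lemma core_in [simp]: "core b \<in> lvs b"
  by (induction b) (auto split: kind.split)

lemma core_notin: "lvs b \<inter> X = {} \<Longrightarrow> core b \<notin> X"
  using core_in[of b] by blast

lemma tip_in [simp]: "tip b \<in> lvs b"
  by (induction b) auto

lemma dual_tree_in: "(u, i, v) \<in> dual_tree b \<Longrightarrow> u \<in> lvs b \<and> v \<in> lvs b"
proof (induction b)
  case (Bracket j s t)
  then show ?case by (auto split: kind.splits)
qed simp

lemma fits_cong:
  assumes "\<And>u i v. u \<in> lvs b \<Longrightarrow> v \<in> lvs b \<Longrightarrow> (u, i, v) \<in> E \<longleftrightarrow> (u, i, v) \<in> E'"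
  shows "fits E b \<longleftrightarrow> fits E' b"
  using assms
proof (induction b)
  case (Bracket i s t)
  have "cross E (lvs s) (lvs t) = cross E' (lvs s) (lvs t)"
    using Bracket.prems by (auto simp: cross_def)
  moreover have "fits E s \<longleftrightarrow> fits E' s" "fits E t \<longleftrightarrow> fits E' t"
    using Bracket.prems by (auto intro!: Bracket.IH)
  ultimately show ?case by simp
qed simp

lemma fits_dual_tree: "normal b \<Longrightarrow> fits (dual_tree b) b"
proof (induction b)
  case (Bracket i s t)
  let ?e = "(core s, i, case i of First \<Rightarrow> core t | Second \<Rightarrow> tip t)"
  have dis: "lvs s \<inter> lvs t = {}" and n: "normal s" "normal t" using Bracket.prems by auto
  have v: "(case i of First \<Rightarrow> core t | Second \<Rightarrow> tip t) \<in> lvs t" by (cases i) auto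
  have "cross (dual_tree (Bracket i s t)) (lvs s) (lvs t) = {?e}"
    using dis v by (auto simp: cross_def dest: dual_tree_in)
  moreover have "fits (dual_tree (Bracket i s t)) s \<longleftrightarrow> fits (dual_tree s) s"
    using dis v by (intro fits_cong) (auto dest: dual_tree_in)
  moreover have "fits (dual_tree (Bracket i s t)) t \<longleftrightarrow> fits (dual_tree t) t"
    using dis v core_notin[OF dis] by (intro fits_cong) (auto dest: dual_tree_in)
  ultimately show ?case using Bracket.IH n by simp
qed simp

text \<open>A fitting edge set connects the leaves.\<close>

lemma fits_connected:
  assumes "fits E b" "x \<in> lvs b" "x \<in> X" "y \<in> lvs b" "y \<notin> X"
  shows "\<exists>u i v. (u, i, v) \<in> E \<and> u \<in> lvs b \<and> v \<in> lvs b \<and> (u \<in> X \<longleftrightarrow> v \<notin> X)"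
  using assms
proof (induction b arbitrary: x y)
  case (Bracket i s t)
  show ?case
  proof (cases "(\<exists>x\<in>lvs s. \<exists>y\<in>lvs s. x \<in> X \<and> y \<notin> X) \<or> (\<exists>x\<in>lvs t. \<exists>y\<in>lvs t. x \<in> X \<and> y \<notin> X)")
    case True
    then show ?thesis
    proof (elim disjE bexE conjE)
      fix x y
      assume "x \<in> lvs s" "y \<in> lvs s" "x \<in> X" "y \<notin> X"
      with Bracket.IH(1)[of x y] Bracket.prems(1)
      show ?thesis by (simp, blast)
    next
      fix x y
      assume "x \<in> lvs t" "y \<in> lvs t" "x \<in> X" "y \<notin> X"
      with Bracket.IH(2)[of x y] Bracket.prems(1)
      show ?thesis by (simp, blast)
    qed
  next
    case False
    obtain u v where "cross E (lvs s) (lvs t) = {(u, i, v)}" using Bracket.prems(1) by auto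
    then have "(u, i, v) \<in> cross E (lvs s) (lvs t)" by simp
    then have "(u, i, v) \<in> E" "u \<in> lvs s \<and> v \<in> lvs t \<or> u \<in> lvs t \<and> v \<in> lvs s"
      by (auto simp: cross_def)
    moreover have "(u \<in> X) \<noteq> (v \<in> X)"
      using False Bracket.prems(2-5) calculation(2) by auto
    ultimately show ?thesis by auto
  qed
qed auto

section \<open>Spines\<close>

text \<open>In a normal monomial the left factor of a first bracket is a single generator, so \<open>leaves s\<close> is
  then a one-element list.\<close>

primrec spine :: "'a monomial \<Rightarrow> 'a list" where
  "spine (Gen a) = []"
| "spine (Bracket i s t) = (case i of First \<Rightarrow> leaves s @ spine t | Second \<Rightarrow> spine t)"

lemma spine_subset: "set (spine b) \<subseteq> lvs b"
  by (induction b) (auto split: kind.splits)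

lemma last_leaf_notin_spine: "normal b \<Longrightarrow> last_leaf b \<notin> set (spine b)"
proof (induction b)
  case (Bracket i s t)
  then show ?case using last_leaf_in[of t] by (auto split: kind.splits)
qed simp

lemma distinct_spine: "normal b \<Longrightarrow> distinct (spine b)"
proof (induction b)
  case (Bracket i s t)
  then show ?case using spine_subset[of t] by (auto split: kind.splits)
qed simp

lemma core_eq_hd_spine: "normal b \<Longrightarrow> core b = hd (spine b @ [last_leaf b])"
  by (induction b) (auto split: kind.splits)

lemma successively_spine:
  "normal b \<Longrightarrow> successively (\<lambda>u v. (u, First, v) \<in> dual_tree b) (spine b @ [last_leaf b])"
proof (induction b)
  case (Bracket i s t)
  have IH: "successively (\<lambda>u v. (u, First, v) \<in> dual_tree (Bracket i s t)) (spine t @ [last_leaf t])"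
    using Bracket by (auto elim!: successively_mono)
  show ?case
  proof (cases i)
    case First
    then obtain a where s: "s = Gen a" using Bracket.prems by auto
    have "(a, First, hd (spine t @ [last_leaf t])) \<in> dual_tree (Bracket i s t)"
      using First s Bracket.prems core_eq_hd_spine[of t] by simp
    then show ?thesis
      using IH First s by (simp add: successively_Cons)
  next
    case Second
    then show ?thesis using IH by simp
  qed
qed simp

text \<open>A path of colour \<open>First\<close> that ends at the last leaf of a fitting normal monomial has to be broken
  along the spine, from its far end: the bracket that separates two consecutive vertices of the path
  is a first bracket, so its left factor is the single generator that is split off.\<close>

lemma subseq_spine:
  assumes "normal b" "fits E b" "set rs \<subseteq> lvs b" "distinct (rs @ [last_leaf b])"
    "successively (\<lambda>u v. (u, First, v) \<in> E) (rs @ [last_leaf b])"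
  shows "subseq rs (spine b)"
  using assms
proof (induction b arbitrary: rs)
  case (Gen a)
  then show ?case by (cases rs) auto
next
  case (Bracket i s t)
  obtain u0 v0 where cr: "cross E (lvs s) (lvs t) = {(u0, i, v0)}" using Bracket.prems(2) by auto
  have n: "normal s" "normal t" "lvs s \<inter> lvs t = {}" using Bracket.prems(1) by auto
  show ?case
  proof (cases "\<exists>x\<in>set rs. x \<in> lvs s")
    case False
    then have "subseq rs (spine t)"
      using Bracket.prems n by (intro Bracket.IH(2)) auto
    then show ?thesis by (auto split: kind.splits)
  next
    case True
    then obtain ps x zs where rs: "rs = ps @ x # zs" and x: "x \<in> lvs s" and zs: "\<forall>z\<in>set zs. z \<notin> lvs s"
      using split_list_last_prop[of rs "\<lambda>x. x \<in> lvs s"] by blast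
    have zst: "set zs \<subseteq> lvs t" using zs Bracket.prems(3) rs by auto
    define y where "y = hd (zs @ [last_leaf t])"
    have y: "y \<in> lvs t" using zst last_leaf_in[of t] unfolding y_def by (cases zs) auto
    have succ: "successively (\<lambda>u v. (u, First, v) \<in> E) (ps @ x # zs @ [last_leaf t])"
      using Bracket.prems(5) rs by simp
    then have "(x, First, y) \<in> E" and succ_zs: "successively (\<lambda>u v. (u, First, v) \<in> E) (zs @ [last_leaf t])"
      by (auto simp: successively_append_iff successively_Cons y_def)
    then have xy: "(x, First, y) \<in> cross E (lvs s) (lvs t)" using x y by (auto simp: cross_def)
    then have i: "i = First" and u0: "u0 = x" using cr by auto
    then obtain a where s: "s = Gen a" using Bracket.prems(1) by auto
    have a: "a = x" using x s by simp
    \<comment> \<open>A predecessor of \<open>x\<close> on the path would give a second edge across the bracket.\<close>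
    have ps: "ps = []"
    proof (rule ccontr)
      assume "ps \<noteq> []"
      then have l: "last ps \<in> set ps" "(last ps, First, x) \<in> E"
        using succ by (auto simp: successively_append_iff)
      then have "last ps \<noteq> x" using Bracket.prems(4) rs by auto
      moreover have "last ps \<in> lvs t" using l Bracket.prems(3) rs s a calculation by auto
      then have "(last ps, First, x) \<in> cross E (lvs s) (lvs t)" using l x by (auto simp: cross_def)
      ultimately show False using cr u0 by auto
    qed
    have "subseq zs (spine t)"
      using Bracket.prems n rs zst succ_zs by (intro Bracket.IH(2)) auto
    then show ?thesis using i s a rs ps by simp
  qed
qed

section \<open>Words of monomials\<close>

text \<open>The monomial whose word consists of the letters \<open>xs\<close>, with their brackets, followed by the word
  of \<open>T\<close>.\<close>

definition graft :: "(kind \<times> 'a monomial) list \<Rightarrow> 'a monomial \<Rightarrow> 'a monomial" where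
  "graft xs T = foldr (\<lambda>(i, s) t. Bracket i s t) xs T"

lemma graft_simps [simp]:
  "graft [] T = T" "graft ((i, s) # xs) T = Bracket i s (graft xs T)"
  "graft (xs @ [(i, s)]) T = graft xs (Bracket i s T)"
  by (simp_all add: graft_def)

lemma lvs_subset_graft: "lvs T \<subseteq> lvs (graft xs T)"
  by (induction xs) auto

lemma graft_last_leaf: "\<exists>xs. b = graft xs (Gen (last_leaf b))"
proof (induction b)
  case (Gen a)
  show ?case by (rule exI[of _ "[]"]) simp
next
  case (Bracket i s t)
  then obtain xs where "t = graft xs (Gen (last_leaf t))" by blast
  then have "Bracket i s t = graft ((i, s) # xs) (Gen (last_leaf (Bracket i s t)))" by simp
  then show ?case by blast
qed

lemma normal_graft: "normal (graft xs T) \<Longrightarrow> normal T"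
  by (induction xs) auto

lemma fits_graft: "fits E (graft xs T) \<Longrightarrow> fits E T"
  by (induction xs) auto

lemma lvs_graft_psubset: "normal (graft (x # xs) T) \<Longrightarrow> lvs T \<subset> lvs (graft (x # xs) T)"
proof -
  assume n: "normal (graft (x # xs) T)"
  obtain i s where x: "x = (i, s)" by (cases x)
  have "lvs s \<inter> lvs T = {}" using n lvs_subset_graft[of T xs] x by auto
  then have "last_leaf s \<notin> lvs T" using last_leaf_in[of s] by blast
  then show ?thesis using lvs_subset_graft[of T "x # xs"] x by auto
qed

lemma core_graft: "normal (graft xs U) \<Longrightarrow> core (graft xs U) = core U \<or> core (graft xs U) \<notin> lvs U"
proof (induction xs)
  case (Cons x xs)
  obtain i s where x: "x = (i, s)" by (cases x)
  have "core s \<notin> lvs U" using Cons.prems x lvs_subset_graft[of U xs] by (intro core_notin) auto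
  then show ?case using Cons x by (auto split: kind.splits)
qed simp

lemma tip_graft: "normal (graft xs U) \<Longrightarrow> tip (graft xs U) = tip U \<or> tip (graft xs U) \<notin> lvs U"
proof (cases xs)
  case (Cons x xs')
  assume n: "normal (graft xs U)"
  obtain i s where x: "x = (i, s)" by (cases x)
  have "core s \<notin> lvs U" using n Cons x lvs_subset_graft[of U xs'] by (intro core_notin) auto
  then show ?thesis using x Cons by simp
qed simp

text \<open>Letters put in front of \<open>U\<close> are attached to \<open>U\<close> only at its core, in colour \<open>First\<close>, or at its tip,
  in colour \<open>Second\<close>.\<close>

lemma dual_tree_graft:
  assumes "normal (graft xs U)" "(u, i, v) \<in> dual_tree (graft xs U)"
  shows "(u, i, v) \<in> dual_tree U \<or> u \<notin> lvs U \<and> (v \<notin> lvs U \<or> i = First \<and> v = core U \<or> i = Second \<and> v = tip U)"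
  using assms
proof (induction xs)
  case (Cons x xs)
  obtain j s where x: "x = (j, s)" by (cases x)
  have n: "normal (graft xs U)" and dis: "lvs s \<inter> lvs U = {}"
    using Cons.prems(1) x lvs_subset_graft[of U xs] by auto
  have "(u, i, v) = (core s, j, case j of First \<Rightarrow> core (graft xs U) | Second \<Rightarrow> tip (graft xs U))
      \<or> (u, i, v) \<in> dual_tree s \<or> (u, i, v) \<in> dual_tree (graft xs U)"
    using Cons.prems(2) x by simp
  then show ?case
  proof (elim disjE)
    assume e: "(u, i, v) = (core s, j, case j of First \<Rightarrow> core (graft xs U) | Second \<Rightarrow> tip (graft xs U))"
    then have "u \<notin> lvs U" using core_notin[OF dis] by simp
    then show ?thesis using e core_graft[OF n] tip_graft[OF n] by (cases j) auto
  next
    assume "(u, i, v) \<in> dual_tree s"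
    then show ?thesis using dis by (auto dest: dual_tree_in)
  next
    assume "(u, i, v) \<in> dual_tree (graft xs U)"
    then show ?thesis using Cons.IH n by blast
  qed
qed simp

lemma spine_graft_subset: "normal (graft xs U) \<Longrightarrow> set (spine (graft xs U)) \<inter> lvs U \<subseteq> set (spine U)"
proof (induction xs)
  case (Cons x xs)
  obtain i s where x: "x = (i, s)" by (cases x)
  have "lvs s \<inter> lvs U = {}" using Cons.prems x lvs_subset_graft[of U xs] by auto
  then show ?case using Cons x by (auto split: kind.splits)
qed simp

lemma First_edge_in_spine:
  assumes "normal (graft xs U)" "fits E (graft xs U)" "(u, First, v) \<in> E"
    "u \<in> lvs U" "v \<in> lvs (graft xs U)" "v \<notin> lvs U"
  shows "v \<in> set (spine (graft xs U))"
  using assms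
proof (induction xs)
  case (Cons x xs)
  obtain i s where x: "x = (i, s)" by (cases x)
  show ?case
  proof (cases "v \<in> lvs s")
    case True
    have "(u, First, v) \<in> cross E (lvs s) (lvs (graft xs U))"
      using Cons.prems True lvs_subset_graft[of U xs] by (auto simp: cross_def)
    then have i: "i = First" using Cons.prems(2) x by auto
    then show ?thesis using x True by simp
  next
    case False
    then have "v \<in> set (spine (graft xs U))" using Cons x by auto
    then show ?thesis using x by (auto split: kind.splits)
  qed
qed simp

section \<open>Triangularity\<close>

text \<open>Lexicographic comparison decided at a position that both lists have. Unlike the usual
  lexicographic order it excludes proper prefixes, and therefore persists when the lists are
  continued arbitrarily.\<close>

definition diff_less :: "nat list \<Rightarrow> nat list \<Rightarrow> bool" where
  "diff_less xs ys \<longleftrightarrow> (\<exists>ps a b us vs. xs = ps @ a # us \<and> ys = ps @ b # vs \<and> a < b)"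

lemma diff_less_Cons: "a < b \<Longrightarrow> diff_less (a # us) (b # vs)"
  unfolding diff_less_def by (metis append_Nil)

lemma diff_less_append: "diff_less xs ys \<Longrightarrow> diff_less (ps @ xs @ us) (ps @ ys @ vs)"
  unfolding diff_less_def by (metis append.assoc append_Cons)

lemma diff_less_Cons_same [simp]: "diff_less (a # xs) (a # ys) \<longleftrightarrow> diff_less xs ys"
proof
  assume "diff_less (a # xs) (a # ys)"
  then obtain ps c d us vs where "a # xs = ps @ c # us" "a # ys = ps @ d # vs" "c < d"
    unfolding diff_less_def by blast
  then show "diff_less xs ys"
    unfolding diff_less_def by (cases ps) auto
next
  assume "diff_less xs ys"
  then show "diff_less (a # xs) (a # ys)" using diff_less_append[of xs ys "[a]" "[]" "[]"] by simp
qed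

lemma diff_less_imp_less: "diff_less xs ys \<Longrightarrow> xs < ys"
proof -
  have "ps @ a # us < ps @ b # vs" if "a < b" for ps us vs and a b :: nat
    using that by (induction ps) auto
  then show "diff_less xs ys \<Longrightarrow> xs < ys" unfolding diff_less_def by blast
qed

text \<open>Letters are listed from the right end of the word. A letter of a first bracket is encoded by \<open>1\<close>; a
  letter \<open>s\<close> of a second bracket by \<open>0\<close>, the rank \<open>r\<close> of its maximum, the length of its spine, its
  size (entered as \<open>n - size\<close>, since larger letters come first), and its own code.\<close>

primrec code :: "('a \<Rightarrow> nat) \<Rightarrow> nat \<Rightarrow> 'a monomial \<Rightarrow> nat list" where
  "code r n (Gen a) = []"
| "code r n (Bracket i s t) = code r n t @ (case i of First \<Rightarrow> [1]
    | Second \<Rightarrow> 0 # r (last_leaf s) # length (spine s) # (n - length (leaves s)) # code r n s)"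

text \<open>Spine lengths are compared first; only for equal spines does the code decide.\<close>

definition key :: "('a \<Rightarrow> nat) \<Rightarrow> nat \<Rightarrow> 'a monomial \<Rightarrow> nat list" where
  "key r n b = length (spine b) # code r n b"

lemma code_graft: "\<exists>us. code r n (graft xs T) = code r n T @ us"
proof (induction xs)
  case (Cons x xs)
  then show ?case by (cases x) auto
qed simp

lemma length_leaves: "normal b \<Longrightarrow> length (leaves b) = card (lvs b)"
  by (simp add: distinct_card normal_distinct)

text \<open>The function \<open>r\<close> ranks the generators, and \<open>n\<close> bounds the number of leaves. The spine of \<open>b\<close> embeds
  in that of \<open>b'\<close>; if the two agree, the words of \<open>b\<close> and \<open>b'\<close> are compared from the right. With a
  common final part \<open>T\<close>, the preceding letters are \<open>x\<close> in \<open>b\<close> and \<open>y\<close> in \<open>b'\<close>, and exactly one edge of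
  the tree of \<open>b\<close> joins \<open>y\<close> to \<open>T\<close>. There are at most two candidates for this edge, and the proof
  shows that \<open>y\<close> is \<open>x\<close> or has a larger code.\<close>

lemma key_triangular:
  fixes b b' :: "'a::linorder monomial"
  assumes "normal b" "normal b'" "lvs b' = lvs b" "fits (dual_tree b) b'"
    and "\<And>x y. x \<in> lvs b \<Longrightarrow> y \<in> lvs b \<Longrightarrow> x < y \<Longrightarrow> r x < (r y :: nat)" "card (lvs b) \<le> n"
  shows "b' = b \<or> diff_less (key r n b) (key r n b')"
  using assms
proof (induction "length (leaves b)" arbitrary: b b' rule: less_induct)
  case less
  note nb = less.prems(1) and nb' = less.prems(2) and lvs_eq = less.prems(3) and fits = less.prems(4)
  let ?E = "dual_tree b"
  have ll: "last_leaf b' = last_leaf b"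
    using last_leaf_eq_Max[OF nb] last_leaf_eq_Max[OF nb'] lvs_eq by simp
  have sub: "subseq (spine b) (spine b')"
    using spine_subset[of b] successively_spine[OF nb] distinct_spine[OF nb] last_leaf_notin_spine[OF nb] ll lvs_eq
    by (intro subseq_spine[OF nb' fits]) auto
  show ?case
  proof (cases "spine b' = spine b")
    case False
    then have "length (spine b) < length (spine b')"
      using sub list_emb_length[OF sub] subseq_same_length[OF sub] by fastforce
    then show ?thesis by (simp add: key_def diff_less_Cons)
  next
    case same_spine: True
    have common: "b' = b \<or> diff_less (code r n b) (code r n b')"
      if "b = graft xs T" "b' = graft ys T" for xs ys T
      using that
    proof (induction xs arbitrary: ys T rule: rev_induct)
      case Nil
      then have "ys = []"
        using lvs_graft_psubset[of "hd ys" "tl ys" T] nb' lvs_eq by (cases ys) auto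
      then show ?case using Nil by simp
    next
      case (snoc ix xs)
      obtain i x where ix: "ix = (i, x)" by (cases ix)
      have "ys \<noteq> []"
        using snoc.prems lvs_graft_psubset[of "hd (xs @ [ix])" "tl (xs @ [ix])" T] nb lvs_eq by auto
      then obtain ys' j y where ys: "ys = ys' @ [(j, y)]" by (metis rev_exhaust surj_pair)
      define U where "U = Bracket i x T"
      define V where "V = Bracket j y T"
      have b: "b = graft xs U" and b': "b' = graft ys' V"
        using snoc.prems ix ys U_def V_def by auto
      have nU: "normal U" and nV: "normal V"
        using normal_graft nb nb' b b' by blast+
      then have nx: "normal x" and ny: "normal y" and xT: "lvs x \<inter> lvs T = {}" and yT: "lvs y \<inter> lvs T = {}"
        unfolding U_def V_def by auto
      have fV: "fits ?E V" using fits_graft fits b' by metis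
      then have fy: "fits ?E y" by (simp add: V_def)
      have Ub: "lvs U \<subseteq> lvs b" and Vb: "lvs V \<subseteq> lvs b"
        using lvs_subset_graft b b' lvs_eq by metis+
      obtain u v where cr: "cross ?E (lvs y) (lvs T) = {(u, j, v)}"
        using fV by (auto simp: V_def)
      then have "(u, j, v) \<in> cross ?E (lvs y) (lvs T)" by simp
      then have uv: "(u, j, v) \<in> ?E" "u \<in> lvs y \<and> v \<in> lvs T \<or> u \<in> lvs T \<and> v \<in> lvs y"
        by (auto simp: cross_def)
      have edge: "(u, k, v) \<in> dual_tree U \<or>
          u \<notin> lvs U \<and> (v \<notin> lvs U \<or> k = First \<and> v = core U \<or> k = Second \<and> v = tip U)"
        if "(u, k, v) \<in> ?E" for u k v
        using dual_tree_graft[of xs U u k v] nb b that by blast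
      \<comment> \<open>The edge between \<open>y\<close> and \<open>T\<close> either comes from \<open>x\<close> or from a letter in front of \<open>x\<close>.\<close>
      have uvU: "(u, j, v) = (core x, i, case i of First \<Rightarrow> core T | Second \<Rightarrow> tip T) \<or>
          u \<notin> lvs U \<and> (j = First \<and> v = core U \<or> j = Second \<and> v = tip U)"
        using edge[OF uv(1)] uv(2) yT xT unfolding U_def
        by (auto dest!: dual_tree_in)
      obtain us where us: "code r n b = code r n U @ us" using code_graft b by blast
      obtain vs where vs: "code r n b' = code r n V @ vs" using code_graft b' by blast
      have first_diff: "diff_less (code r n b) (code r n b')"
        if "code r n U = code r n T @ p" "code r n V = code r n T @ q" "diff_less p q" for p q
        using diff_less_append[OF that(3), of "code r n T" us vs] us vs that by simp
      consider "(j, y) = (i, x)" | "diff_less (code r n b) (code r n b')"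
      proof (cases i)
        case i: First
        then obtain a where x: "x = Gen a" using nU by (auto simp: U_def)
        have "(u, j, v) = (a, First, core T)"
          using uvU uv(2) yT xT x i by (auto simp: U_def)
        then have "j = First" "a \<in> lvs y" using uv(2) xT x by auto
        moreover obtain c where "y = Gen c" using nV \<open>j = First\<close> by (auto simp: V_def)
        ultimately show thesis using i x that by simp
      next
        case i: Second
        show thesis
        proof (cases j)
          case First
          then have "diff_less (code r n b) (code r n b')"
            using i by (intro first_diff) (auto simp: U_def V_def diff_less_Cons)
          then show thesis using that by blast
        next
          case j: Second
          have "u = core x"
            using uvU uv(2) yT xT i j core_notin[OF xT] by (auto simp: U_def)
          then have core_y: "core x \<in> lvs y" using uv(2) core_notin[OF xT] by simp
          have EU: "dual_tree x \<subseteq> dual_tree U" by (auto simp: U_def)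
          have UE: "dual_tree U \<subseteq> ?E"
          proof -
            have "dual_tree U \<subseteq> dual_tree (graft xs U)" by (induction xs) auto
            then show ?thesis using b by simp
          qed
          \<comment> \<open>An edge of colour \<open>First\<close> inside \<open>x\<close> that leaves \<open>y\<close> would end in the spine of \<open>b'\<close>, which is
            the spine of \<open>b\<close> and hence disjoint from \<open>x\<close>. So \<open>y\<close> contains the spine path of \<open>x\<close> up to
            the maximum of \<open>x\<close>.\<close>
          have step: "w' \<in> lvs y" if "w \<in> lvs y" "(w, First, w') \<in> dual_tree x" for w w'
          proof (rule ccontr)
            assume w': "w' \<notin> lvs y"
            have w'x: "w' \<in> lvs x" using that(2) dual_tree_in by metis
            then have "w' \<notin> lvs V" using w' xT by (auto simp: V_def)
            moreover have "w' \<in> lvs b'" using w'x Ub lvs_eq by (auto simp: U_def)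
            ultimately have "w' \<in> set (spine b')"
              using First_edge_in_spine[of ys' V ?E w w'] nb' fits b' that EU UE by (auto simp: V_def)
            then have "w' \<in> set (spine U)"
              using same_spine spine_graft_subset[of xs U] nb b w'x by (auto simp: U_def)
            then show False using spine_subset[of T] xT w'x i by (auto simp: U_def)
          qed
          have path: "set ps \<subseteq> lvs y"
            if "successively (\<lambda>u v. (u, First, v) \<in> dual_tree x) ps" "ps \<noteq> []" "hd ps \<in> lvs y" for ps
            using that by (induction ps rule: induct_list012) (auto intro: step)
          have path_y: "set (spine x @ [last_leaf x]) \<subseteq> lvs y"
            using core_y core_eq_hd_spine[OF nx] by (intro path successively_spine nx) auto
          then have ll_y: "last_leaf x \<in> lvs y" by simp
          have ll_le: "last_leaf x \<le> last_leaf y" using last_leaf_max[OF ny ll_y] .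
          have codeU: "code r n U = code r n T @ (0 # r (last_leaf x) # length (spine x) # (n - length (leaves x)) # code r n x)"
            using i by (simp add: U_def)
          have codeV: "code r n V = code r n T @ (0 # r (last_leaf y) # length (spine y) # (n - length (leaves y)) # code r n y)"
            using j by (simp add: V_def)
          show thesis
          proof (cases "last_leaf x = last_leaf y")
            case False
            then have "last_leaf x < last_leaf y" using ll_le by simp
            moreover have "last_leaf x \<in> lvs b" "last_leaf y \<in> lvs b"
              using Ub Vb by (auto simp: U_def V_def)
            ultimately have "r (last_leaf x) < r (last_leaf y)" using less.prems(5) by blast
            then show thesis
              by (intro that(2) first_diff[OF codeU codeV]) (simp add: diff_less_Cons)
          next
            case ll_eq: True
            have "successively (\<lambda>u v. (u, First, v) \<in> ?E) (spine x @ [last_leaf x])"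
              using successively_spine[OF nx] EU UE by (auto elim!: successively_mono)
            then have sub_y: "subseq (spine x) (spine y)"
              using path_y distinct_spine[OF nx] last_leaf_notin_spine[OF nx] ll_eq
              by (intro subseq_spine[OF ny fy]) auto
            show thesis
            proof (cases "spine y = spine x")
              case False
              then have "length (spine x) < length (spine y)"
                using list_emb_length[OF sub_y] subseq_same_length[OF sub_y] by fastforce
              then show thesis
                using ll_eq by (intro that(2) first_diff[OF codeU codeV]) (simp add: diff_less_Cons)
            next
              case sp: True
              \<comment> \<open>A letter of a second bracket is a generator or a first bracket. In the latter case \<open>y\<close>
                splits off the core of \<open>x\<close>, the only vertex through which \<open>x\<close> is connected to the
                rest of the tree; what remains of \<open>y\<close> is connected and contains the maximum of \<open>x\<close>.\<close>
              have yx: "lvs y \<subseteq> lvs x"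
              proof (cases y)
                case (Gen c)
                then show ?thesis using ll_eq last_leaf_in[of x] by auto
              next
                case (Bracket k y1 y2)
                have "k = First" using nV j Bracket by (cases k) (auto simp: V_def)
                then obtain c where y: "y = Bracket First (Gen c) y2" using ny Bracket by auto
                have spx: "spine x = c # spine y2" using sp y by simp
                then have cx: "core x = c" using core_eq_hd_spine[OF nx] by simp
                have cy2: "c \<notin> lvs y2" using ny y by auto
                have c: "c \<in> lvs x" using cx core_in[of x] by simp
                have "z \<in> lvs x" if z: "z \<in> lvs y2" for z
                proof (rule ccontr)
                  assume "z \<notin> lvs x"
                  moreover have "last_leaf y2 \<in> lvs x" using ll_eq y last_leaf_in[of x] by simp
                  moreover have "fits ?E y2" using fy y by simp
                  ultimately obtain u k v where e: "(u, k, v) \<in> ?E" "u \<in> lvs y2" "v \<in> lvs y2"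
                      "u \<in> lvs x \<longleftrightarrow> v \<notin> lvs x"
                    using fits_connected[of ?E y2 "last_leaf y2" "lvs x" z] z by auto
                  have ne: "u \<noteq> core x" "v \<noteq> core x" using e cx cy2 by auto
                  show False
                    using edge[OF e(1)] e(4) ne xT i core_in[of T] unfolding U_def
                    by (auto dest!: dual_tree_in)
                qed
                then show ?thesis using y c by auto
              qed
              show thesis
              proof (cases "lvs y = lvs x")
                case False
                then have "card (lvs y) < card (lvs x)" using yx by (intro psubset_card_mono) auto
                moreover have "card (lvs x) \<le> n"
                  using less.prems(6) card_mono[of "lvs b" "lvs x"] Ub by (auto simp: U_def)
                ultimately have "n - length (leaves x) < n - length (leaves y)"
                  using nx ny by (simp add: length_leaves)
                then show thesis
                  using ll_eq sp by (intro that(2) first_diff[OF codeU codeV]) (simp add: diff_less_Cons)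
              next
                case True
                have "(u, k, v) \<in> ?E \<longleftrightarrow> (u, k, v) \<in> dual_tree x" if "u \<in> lvs x" "v \<in> lvs x" for u k v
                proof
                  assume "(u, k, v) \<in> ?E"
                  from edge[OF this] show "(u, k, v) \<in> dual_tree x"
                    using that xT i unfolding U_def by (auto dest!: dual_tree_in)
                qed (use EU UE in auto)
                then have "fits (dual_tree x) y"
                  using fits_cong[of y ?E "dual_tree x"] fy True by blast
                moreover have "length (leaves x) < length (leaves b)"
                proof -
                  have "last_leaf T \<notin> lvs x" "last_leaf T \<in> lvs U" "lvs x \<subseteq> lvs U"
                    using xT last_leaf_in[of T] by (auto simp: U_def)
                  then have "lvs x \<subset> lvs b" using Ub by blast
                  then show ?thesis using nx nb by (simp add: length_leaves psubset_card_mono)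
                qed
                moreover have "card (lvs x) \<le> n"
                  using less.prems(6) card_mono[of "lvs b" "lvs x"] Ub by (auto simp: U_def)
                moreover have "lvs x \<subseteq> lvs b" using Ub by (auto simp: U_def)
                ultimately have "y = x \<or> diff_less (key r n x) (key r n y)"
                  using less.hyps[of x y] nx ny True less.prems(5) by blast
                then show thesis
                proof
                  assume "y = x"
                  then show thesis using i j that(1) by simp
                next
                  assume "diff_less (key r n x) (key r n y)"
                  then have "diff_less (code r n x) (code r n y)" using sp by (simp add: key_def)
                  then show thesis
                    using ll_eq sp True nx ny
                    by (intro that(2) first_diff[OF codeU codeV]) (simp add: length_leaves)
                qed
              qed
            qed
          qed
        qed
      qed
      then show ?case
      proof cases
        case 1
        then show ?thesis using snoc.IH[of U ys'] b b' by (simp add: U_def V_def)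
      qed blast
    qed
    obtain xs where xs: "b = graft xs (Gen (last_leaf b))" using graft_last_leaf by blast
    obtain ys where ys: "b' = graft ys (Gen (last_leaf b))" using graft_last_leaf[of b'] ll by auto
    show ?thesis using common[OF xs ys] same_spine by (simp add: key_def)
  qed
qed

section \<open>Independence\<close>

text \<open>The tree of a member of the support with the largest key pairs nontrivially with no other member
  of the support.\<close>

lemma normal_combination_zero:
  fixes c :: "'a::linorder monomial \<Rightarrow> 'k::field"
  assumes "finite M" "\<And>b. b \<in> M \<Longrightarrow> normal b \<and> lvs b = A"
    and zero: "(\<Sum>b\<in>M. fscale (c b) (mval b)) = 0"
  shows "\<forall>b\<in>M. c b = 0"
proof (rule ccontr)
  define N where "N = {b \<in> M. c b \<noteq> 0}"
  define r where "r x = card {y \<in> A. y < x}" for x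
  define f where "f = key r (card A)"
  assume "\<not> (\<forall>b\<in>M. c b = 0)"
  then have N: "N \<noteq> {}" "finite N" using assms(1) by (auto simp: N_def)
  have finA: "finite A" using N assms(2) by (auto simp: N_def)
  have r: "r x < r y" if "x \<in> A" "x < y" for x y
    unfolding r_def using that finA by (intro psubset_card_mono) auto
  have "Max (f ` N) \<in> f ` N" using N by simp
  then obtain b0 where b0: "b0 \<in> N" "f b0 = Max (f ` N)" by auto
  have b0N: "normal b0" "lvs b0 = A" "b0 \<in> M" "c b0 \<noteq> 0" using b0(1) assms(2) by (auto simp: N_def)
  obtain h :: "('a, 'k) free_alg \<Rightarrow> 'k" where
    h: "\<And>x y. h (x + y) = h x + h y" "\<And>c x. h (fscale c x) = c * h x"
      "\<And>b. distinct (leaves b) \<Longrightarrow> lvs b = A \<Longrightarrow> h (mval b) = sign (dual_tree b0) b"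
    using pairing_exists[of A "dual_tree b0"] by blast
  have h0: "h 0 = 0" using h(2)[of 0 0] by simp
  have hsum: "h (\<Sum>b\<in>S. fscale (c b) (mval b)) = (\<Sum>b\<in>S. c b * h (mval b))" for S
    by (induction S rule: infinite_finite_induct) (simp_all add: h h0)
  have "c b * h (mval b) = (if b = b0 then c b0 * h (mval b0) else 0)" if "b \<in> M" for b
  proof (cases "b = b0 \<or> c b = 0")
    case True
    then show ?thesis by auto
  next
    case False
    have b: "normal b" "lvs b = A" using assms(2) that by auto
    have "\<not> fits (dual_tree b0) b"
    proof
      assume "fits (dual_tree b0) b"
      then have "f b0 < f b"
        using key_triangular[of b0 b r "card A"] b b0N False r
        by (auto simp: f_def dest: diff_less_imp_less)
      moreover have "f b \<le> Max (f ` N)" using N that False by (auto simp: N_def)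
      ultimately show False using b0 by simp
    qed
    then have "h (mval b) = 0"
      using h(3)[of b] b normal_distinct sign_nonzero by metis
    then show ?thesis using False by simp
  qed
  then have "(\<Sum>b\<in>M. c b * h (mval b)) = (\<Sum>b\<in>M. if b = b0 then c b0 * h (mval b0) else 0)"
    by (intro sum.cong) auto
  also have "\<dots> = c b0 * h (mval b0)" using assms(1) b0N by simp
  finally have "c b0 * h (mval b0) = 0" using zero hsum[of M] h0 by simp
  moreover have "h (mval b0) \<noteq> 0"
    using h(3)[of b0] b0N normal_distinct fits_dual_tree sign_nonzero by metis
  ultimately show False using b0N by simp
qed

lemma inj_on_mval_basis_family:
  "inj_on (mval :: 'a::linorder monomial \<Rightarrow> ('a, 'k::field) free_alg) (basis_family A)"
proof (rule inj_onI, rule ccontr)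
  fix b b' :: "'a monomial"
  assume bb: "b \<in> basis_family A" "b' \<in> basis_family A" "b \<noteq> b'"
    and eq: "(mval b :: ('a, 'k) free_alg) = mval b'"
  define c :: "'a monomial \<Rightarrow> 'k" where "c = (\<lambda>x. if x = b then 1 else - 1)"
  have "(\<Sum>x\<in>{b, b'}. fscale (c x) (mval x)) = 0"
    using bb(3) eq by (simp add: c_def)
  then have "\<forall>x\<in>{b, b'}. c x = 0"
    using bb by (intro normal_combination_zero[where A = A]) (auto simp: basis_family_eq)
  then show False by (simp add: c_def)
qed

lemma independent_basis_family:
  "free_alg.independent ((mval :: 'a::linorder monomial \<Rightarrow> ('a, 'k::field) free_alg) ` basis_family A)"
  unfolding free_alg.independent_explicit_finite_subsets
proof (intro allI impI)
  fix S :: "('a, 'k) free_alg set" and u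
  assume S: "S \<subseteq> mval ` basis_family A" "finite S" and zero: "(\<Sum>v\<in>S. fscale (u v) v) = 0"
  define M where "M = {b \<in> basis_family A. (mval b :: ('a, 'k) free_alg) \<in> S}"
  have img: "mval ` M = S" using S(1) by (auto simp: M_def)
  have inj: "inj_on (mval :: 'a monomial \<Rightarrow> ('a, 'k) free_alg) M"
    using inj_on_mval_basis_family by (rule inj_on_subset) (auto simp: M_def)
  have fin: "finite M" using img inj S(2) finite_imageD by blast
  have "(\<Sum>b\<in>M. fscale (u (mval b)) (mval b)) = 0"
    using zero sum.reindex[OF inj, of "\<lambda>v. fscale (u v) v"] by (simp add: img)
  then have "\<forall>b\<in>M. u (mval b) = 0"
    using fin by (intro normal_combination_zero[where A = A]) (auto simp: M_def basis_family_eq)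
  then show "\<forall>v\<in>S. u v = 0" using img by auto
qed

theorem theorem4:
  fixes A :: "'a::linorder set"
  assumes "finite A" and "card A \<ge> 1"
  shows "inj_on (mval :: 'a monomial \<Rightarrow> ('a, 'k::field_char_0) free_alg) (basis_family A)
    \<and> free_alg.independent ((mval :: 'a monomial \<Rightarrow> ('a, 'k) free_alg) ` basis_family A)
    \<and> free_alg.span ((mval :: 'a monomial \<Rightarrow> ('a, 'k) free_alg) ` basis_family A)
        = multilinear_part A"
  using inj_on_mval_basis_family independent_basis_family span_basis_family by blast

end
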